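(* For any graph $G$ and any noncomplete graph $H$, $$\gamma_r(G\circ H)\le \gamma(G)\,\gamma_r(H).$$
   Context: Graphs are finite, simple and undirected. For a graph $G$, a function $f:V(G)\to\{0,1,2\}$ has weight $w(f)=\sum_{v\in V(G)}f(v)$; a vertex $v$ is undefended with respect to $f$ if $f(v)=0$ and $f(u)=0$ for every $u$ adjacent to $v$. The function $f$ is a weak Roman dominating function (WRDF) on $G$ if for every $v$ with $f(v)=0$ there is a vertex $u$ adjacent to $v$ with $f(u)\in\{1,2\}$ such that the function $f'$ defined by $f'(v)=1$, $f'(u)=f(u)-1$ and $f'(z)=f(z)$ for $z\notin\{u,v\}$ has no undefended vertices. The weak Roman domination number $\gamma_r(G)$ is the minimum weight of a WRDF on $G$. The lexicographic product $G\circ H$ has vertex set $V(G)\times V(H)$, and $(u,v)$ and $(x,y)$ are adjacent iff $ux\in E(G)$, or $u=x$ and $vy\in E(H)$. The domination number $\gamma(G)$ is the minimum cardinality of a set $D\subseteq V(G)$ such that every vertex outside $D$ has a neighbour in $D$. *)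

theory Defs
  imports "Graph_Theory.Graph_Theory"
begin

text \<open>
  A finite simple undirected graph is a \<^locale>\<open>pair_graph\<close>: a finite loopfree symmetric digraph
  whose arcs are ordered pairs of vertices, so each edge is present as two opposite arcs.
  Weight functions are total on the vertex type; only their values on \<^term>\<open>pverts G\<close> matter.
\<close>

definition weight :: "'a pair_pre_digraph \<Rightarrow> ('a \<Rightarrow> nat) \<Rightarrow> nat" where
  "weight G f = (\<Sum>v\<in>pverts G. f v)"

definition undefended :: "'a pair_pre_digraph \<Rightarrow> ('a \<Rightarrow> nat) \<Rightarrow> 'a \<Rightarrow> bool" where
  "undefended G f v \<longleftrightarrow>
     v \<in> pverts G \<and> f v = 0 \<and> (\<forall>u. (u, v) \<in> parcs G \<longrightarrow> f u = 0)"

definition weak_roman_dominating :: "'a pair_pre_digraph \<Rightarrow> ('a \<Rightarrow> nat) \<Rightarrow> bool" where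
  "weak_roman_dominating G f \<longleftrightarrow>
     f ` pverts G \<subseteq> {0, 1, 2} \<and>
     (\<forall>v\<in>pverts G. f v = 0 \<longrightarrow>
        (\<exists>u. (u, v) \<in> parcs G \<and> f u \<in> {1, 2} \<and>
             \<not> (\<exists>z. undefended G (f(v := 1, u := f u - 1)) z)))"

definition weak_roman_domination_number :: "'a pair_pre_digraph \<Rightarrow> nat" where
  "weak_roman_domination_number G = (LEAST w. \<exists>f. weak_roman_dominating G f \<and> weight G f = w)"

definition dominating_set :: "'a pair_pre_digraph \<Rightarrow> 'a set \<Rightarrow> bool" where
  "dominating_set G D \<longleftrightarrow>
     D \<subseteq> pverts G \<and> (\<forall>v\<in>pverts G - D. \<exists>u\<in>D. (u, v) \<in> parcs G)"

definition domination_number :: "'a pair_pre_digraph \<Rightarrow> nat" where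
  "domination_number G = (LEAST k. \<exists>D. dominating_set G D \<and> card D = k)"

definition lexicographic_product ::
  "'a pair_pre_digraph \<Rightarrow> 'b pair_pre_digraph \<Rightarrow> ('a \<times> 'b) pair_pre_digraph" where
  "lexicographic_product G H =
     \<lparr> pverts = pverts G \<times> pverts H,
       parcs = {((u, v), (x, y)) | u v x y.
         (u, v) \<in> pverts G \<times> pverts H \<and> (x, y) \<in> pverts G \<times> pverts H \<and>
         ((u, x) \<in> parcs G \<or> u = x \<and> (v, y) \<in> parcs H)} \<rparr>"

text \<open>
  The graphs \<open>K\<^sub>n\<close> are those of \<^const>\<open>complete_digraph\<close>; the one-vertex graph and the null graph
  are complete.
\<close>

definition complete_graph :: "'a pair_pre_digraph \<Rightarrow> bool" where
  "complete_graph G \<longleftrightarrow> (\<exists>n. complete_digraph n (with_proj G))"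

text \<open>The two minima are attained, and the product is again a finite simple graph.\<close>

lemma weak_roman_domination_number_attained:
  "\<exists>f. weak_roman_dominating G f \<and> weight G f = weak_roman_domination_number G"
proof -
  have "weak_roman_dominating G (\<lambda>_. 1)"
    by (auto simp: weak_roman_dominating_def)
  then have "\<exists>w f. weak_roman_dominating G f \<and> weight G f = w"
    by blast
  then show ?thesis
    unfolding weak_roman_domination_number_def by (rule LeastI_ex)
qed

lemma domination_number_attained:
  "\<exists>D. dominating_set G D \<and> card D = domination_number G"
proof -
  have "dominating_set G (pverts G)"
    by (auto simp: dominating_set_def)
  then have "\<exists>k D. dominating_set G D \<and> card D = k"
    by blast
  then show ?thesis
    unfolding domination_number_def by (rule LeastI_ex)
qed

lemma pair_graph_lexicographic_product:
  assumes "pair_graph G" and "pair_graph H"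
  shows "pair_graph (lexicographic_product G H)"
proof -
  interpret G: pair_graph G by fact
  interpret H: pair_graph H by fact
  let ?P = "lexicographic_product G H"
  have sub: "parcs ?P \<subseteq> pverts ?P \<times> pverts ?P"
    by (auto simp: lexicographic_product_def)
  have fin: "finite (pverts ?P)"
    by (simp add: lexicographic_product_def)
  have "finite (parcs ?P)"
    using finite_subset[OF sub] fin by blast
  moreover have "symmetric (with_proj ?P)"
    by (auto simp: symmetric_def lexicographic_product_def
        intro!: symI dest: G.arcs_symmetric H.arcs_symmetric)
  moreover have "fst e \<noteq> snd e" if "e \<in> parcs ?P" for e
    using that by (auto simp: lexicographic_product_def dest: G.pair_no_loops H.pair_no_loops)
  ultimately show ?thesis
    using sub fin by unfold_locales auto
qed

end

theory Submission
  imports Defs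
begin

text \<open>
  Copy a minimum WRDF \<open>f\<close> of \<open>H\<close> onto every layer of \<open>G \<circ> H\<close> over a minimum dominating set \<open>D\<close>
  of \<open>G\<close>. A vertex in a layer over \<open>D\<close> is defended as in \<open>H\<close>; a vertex in another layer is
  defended from any positive vertex of an adjacent layer over \<open>D\<close>. The latter layer keeps a
  positive vertex after the move because \<open>H\<close> is not complete, so that \<open>f\<close> has weight at least 2.
\<close>

lemma not_complete_graph_obtain:
  assumes "pair_graph H" and "\<not> complete_graph H"
  obtains a b where "a \<in> pverts H" "b \<in> pverts H" "a \<noteq> b" "(a, b) \<notin> parcs H" "(b, a) \<notin> parcs H"
proof (rule ccontr)
  interpret H: pair_graph H by fact
  assume no: "\<not> thesis"
  have "parcs H = {(u, v). (u, v) \<in> pverts H \<times> pverts H \<and> u \<noteq> v}"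
  proof (intro set_eqI iffI)
    fix e assume "e \<in> parcs H"
    then show "e \<in> {(u, v). (u, v) \<in> pverts H \<times> pverts H \<and> u \<noteq> v}"
      by (cases e) (auto dest: H.in_arcsD1 H.in_arcsD2 H.pair_no_loops)
  next
    fix e assume "e \<in> {(u, v). (u, v) \<in> pverts H \<times> pverts H \<and> u \<noteq> v}"
    then show "e \<in> parcs H"
      using no that H.arcs_symmetric by blast
  qed
  then have "complete_digraph (card (pverts H)) (with_proj H)"
    by (simp add: complete_digraph_pair_def)
  then show False
    using assms(2) by (auto simp: complete_graph_def)
qed

lemma weak_roman_dominating_neighbour:
  assumes "weak_roman_dominating H f" and "v \<in> pverts H" and "f v = 0"
  obtains u where "(u, v) \<in> parcs H" "f u > 0"
  using assms unfolding weak_roman_dominating_def by fastforce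

text \<open>If \<open>w\<close> carried the whole weight 1, any move defending another vertex
  \<open>a\<close> would take the only unit from \<open>w\<close> to \<open>a\<close>, so
  \<open>a\<close> would have to be adjacent to every other vertex; a nonadjacent pair rules this
  out. The lemma keeps a layer positive after it sends a unit to another layer.\<close>

lemma weak_roman_dominating_remaining:
  assumes "pair_graph H" and "\<not> complete_graph H"
    and f: "weak_roman_dominating H f" and "f w = 1"
  obtains w' where "w' \<in> pverts H" "w' \<noteq> w" "f w' > 0"
proof (rule ccontr)
  interpret H: pair_graph H by fact
  assume "\<not> thesis"
  with that have zero: "f z = 0" if "z \<in> pverts H" "z \<noteq> w" for z
    using that by blast
  \<comment> \<open>Only \<open>a\<close> must differ from \<open>w\<close>. A nonadjacent pair has
    a member other than \<open>w\<close>, and that member can take the role of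
    \<open>a\<close>.\<close>
  have no: False
    if ab: "a \<in> pverts H" "b \<in> pverts H" "a \<noteq> b" "(a, b) \<notin> parcs H" "a \<noteq> w" for a b
  proof -
    have "f a = 0"
      using zero ab by blast
    then obtain u where u: "(u, a) \<in> parcs H" "f u \<in> {1, 2}"
      and nu: "\<not> (\<exists>z. undefended H (f(a := 1, u := f u - 1)) z)"
      using f ab(1) unfolding weak_roman_dominating_def by blast
    have "u = w"
      using u zero[of u] H.in_arcsD1 H.wellformed by force
    \<comment> \<open>After the move the only unit lies on \<open>a\<close>, which is not adjacent
      to \<open>b\<close>. The case \<open>b = w\<close> is included, since \<open>w\<close> has
      dropped from 1 to 0.\<close>
    have "undefended H (f(a := 1, u := f u - 1)) b"
      unfolding undefended_def
    proof (intro conjI allI impI)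
      show "b \<in> pverts H" by (fact ab(2))
      show "(f(a := 1, u := f u - 1)) b = 0"
        using zero ab \<open>u = w\<close> assms(4) by (cases "b = w") auto
      fix z assume z: "(z, b) \<in> parcs H"
      then have "z \<noteq> a" "z \<in> pverts H"
        using ab H.wellformed by force+
      then show "(f(a := 1, u := f u - 1)) z = 0"
        using zero[of z] \<open>u = w\<close> assms(4) by (cases "z = w") auto
    qed
    then show False using nu by blast
  qed
  from assms(1,2) show False
    by (rule not_complete_graph_obtain) (metis no)
qed

definition layered :: "'a set \<Rightarrow> ('b \<Rightarrow> nat) \<Rightarrow> 'a \<times> 'b \<Rightarrow> nat" where
  "layered D f p = (if fst p \<in> D then f (snd p) else 0)"

lemma weight_layered:
  assumes "finite (pverts G)" and "D \<subseteq> pverts G"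
  shows "weight (lexicographic_product G H) (layered D f) = card D * weight H f"
proof -
  have "weight (lexicographic_product G H) (layered D f)
      = (\<Sum>u\<in>pverts G. \<Sum>v\<in>pverts H. layered D f (u, v))"
    by (simp add: weight_def lexicographic_product_def sum.cartesian_product)
  also have "\<dots> = (\<Sum>u\<in>pverts G. if u \<in> D then weight H f else 0)"
    by (intro sum.cong) (auto simp: layered_def weight_def)
  also have "\<dots> = card D * weight H f"
    using assms by (simp add: sum.If_cases Int_absorb1)
  finally show ?thesis .
qed

text \<open>Each layer contains the arcs of \<open>H\<close>, so a positive neighbour found in
  \<open>H\<close> also defends in the product. Here \<open>h\<close> is the restriction of
  \<open>g\<close> to the layer over \<open>u\<close>: either \<open>f\<close> itself or
  \<open>f\<close> after a move.\<close>

lemma not_undefended_layerI: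
  assumes "pair_graph H" and "u \<in> pverts G" "v \<in> pverts H"
    and gh: "\<And>y. g (u, y) = h y" and nu: "\<not> undefended H h v"
  shows "\<not> undefended (lexicographic_product G H) g (u, v)"
proof (cases "h v = 0")
  interpret H: pair_graph H by fact
  case True
  then obtain w where w: "(w, v) \<in> parcs H" "h w \<noteq> 0"
    using assms(3) nu by (auto simp: undefended_def)
  then have "((u, w), (u, v)) \<in> parcs (lexicographic_product G H)"
    using assms(2,3) H.in_arcsD1 by (auto simp: lexicographic_product_def)
  then show ?thesis
    using w(2) gh[of w] unfolding undefended_def by metis
next
  case False
  then show ?thesis
    using gh by (simp add: undefended_def)
qed

text \<open>A vertex over \<open>x\<close> outside \<open>D\<close> is adjacent to the entire layer
  over some \<open>u\<close> in \<open>D\<close>, so one positive vertex in that layer defends it.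
  Hence only layers over \<open>D\<close> need checking after a move; \<open>g\<close> is arbitrary
  so that moves within a layer and moves between layers are both covered.\<close>

lemma not_undefended_lexicographic_productI:
  assumes G: "pair_graph G" and H: "pair_graph H" and D: "dominating_set G D"
    and positive: "\<And>u. u \<in> D \<Longrightarrow> \<exists>v\<in>pverts H. g (u, v) > 0"
    and defended: "\<And>u v. u \<in> D \<Longrightarrow> v \<in> pverts H \<Longrightarrow>
      \<not> undefended (lexicographic_product G H) g (u, v)"
  shows "\<not> undefended (lexicographic_product G H) g z"
proof
  assume z: "undefended (lexicographic_product G H) g z"
  obtain x y where xy: "z = (x, y)" by fastforce
  have xyin: "x \<in> pverts G" "y \<in> pverts H"
    using z by (auto simp: xy undefended_def lexicographic_product_def)
  then have "x \<notin> D"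
    using z defended xy by blast
  then obtain u where u: "u \<in> D" "(u, x) \<in> parcs G"
    using D xyin by (auto simp: dominating_set_def)
  then obtain v where v: "v \<in> pverts H" "g (u, v) > 0"
    using positive by blast
  have "((u, v), z) \<in> parcs (lexicographic_product G H)"
    using u v xyin D by (auto simp: xy lexicographic_product_def dominating_set_def)
  then show False
    using z v by (auto simp: undefended_def)
qed

lemma weak_roman_dominating_layered:
  assumes G: "pair_graph G" and H: "pair_graph H" and nc: "\<not> complete_graph H"
    and D: "dominating_set G D" and f: "weak_roman_dominating H f"
  shows "weak_roman_dominating (lexicographic_product G H) (layered D f)"
proof -
  interpret G: pair_graph G by fact
  interpret H: pair_graph H by fact
  let ?P = "lexicographic_product G H" and ?F = "layered D f"
  have DG: "D \<subseteq> pverts G"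
    using D by (simp add: dominating_set_def)
  obtain a where a: "a \<in> pverts H"
    using not_complete_graph_obtain[OF H nc] by metis
  \<comment> \<open>Either \<open>a\<close> is positive itself or it has a positive
    neighbour.\<close>
  have pos: "\<exists>w\<in>pverts H. f w > 0"
    using weak_roman_dominating_neighbour[OF f a] a H.wellformed by (metis H.in_arcsD1 neq0_conv)
  have fdef: "\<not> undefended H f v" for v
    using weak_roman_dominating_neighbour[OF f, of v] by (auto simp: undefended_def)
  have inner: "\<exists>p. (p, (u, v)) \<in> parcs ?P \<and> ?F p \<in> {1, 2} \<and>
      \<not> (\<exists>z. undefended ?P (?F((u, v) := 1, p := ?F p - 1)) z)"
    if u: "u \<in> D" and v: "v \<in> pverts H" "f v = 0" for u v
  proof -
    obtain w where w: "(w, v) \<in> parcs H" "f w \<in> {1, 2}"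
      and nu: "\<not> (\<exists>z. undefended H (f(v := 1, w := f w - 1)) z)"
      using f v unfolding weak_roman_dominating_def by blast
    have wH: "w \<in> pverts H" and wv: "w \<noteq> v"
      using w(1) H.in_arcsD1 H.pair_no_loops by force+
    \<comment> \<open>The move stays in the layer over \<open>u\<close>, where it copies the move
      that \<open>f\<close> admits in \<open>H\<close>; all other layers over \<open>D\<close> still
      carry \<open>f\<close>.\<close>
    let ?g = "?F((u, v) := 1, (u, w) := ?F (u, w) - 1)"
    have "\<not> undefended ?P ?g z" for z
    proof (rule not_undefended_lexicographic_productI[OF G H D])
      fix x assume x: "x \<in> D"
      \<comment> \<open>In the layer over \<open>u\<close> the witness is \<open>v\<close>: it has
        received a unit, and the decrement hits \<open>w\<close>, a different vertex.\<close>
      show "\<exists>y\<in>pverts H. ?g (x, y) > 0"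
        using x v wv pos by (cases "x = u") (auto simp: layered_def intro!: bexI[of _ v])
      fix y assume y: "y \<in> pverts H"
      show "\<not> undefended ?P ?g (x, y)"
      proof (cases "x = u")
        case True
        show ?thesis
          by (rule not_undefended_layerI[where h = "f(v := 1, w := f w - 1)", OF H subsetD[OF DG x] y])
            (use True u nu in \<open>auto simp: layered_def\<close>)
      next
        case False
        show ?thesis
          by (rule not_undefended_layerI[where h = f, OF H subsetD[OF DG x] y]) (use False x fdef in \<open>auto simp: layered_def\<close>)
      qed
    qed
    moreover have "((u, w), (u, v)) \<in> parcs ?P"
      using u DG w(1) wH v by (auto simp: lexicographic_product_def)
    moreover have "?F (u, w) \<in> {1, 2}"
      using w(2) u by (simp add: layered_def)
    ultimately show ?thesis by blast
  qed
  have outer: "\<exists>p. (p, (x, v)) \<in> parcs ?P \<and> ?F p \<in> {1, 2} \<and>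
      \<not> (\<exists>z. undefended ?P (?F((x, v) := 1, p := ?F p - 1)) z)"
    if x: "x \<in> pverts G" "x \<notin> D" and v: "v \<in> pverts H" for x v
  proof -
    obtain u where u: "u \<in> D" "(u, x) \<in> parcs G"
      using D x by (auto simp: dominating_set_def)
    then have "u \<noteq> x" using x by blast
    \<comment> \<open>Any positive \<open>w\<close> will do, whatever its relation to
      \<open>v\<close>, because the layers over \<open>u\<close> and \<open>x\<close> are completely
      joined.\<close>
    obtain w where w: "w \<in> pverts H" "f w > 0"
      using pos by blast
    then have w12: "f w \<in> {1, 2}"
      using f by (fastforce simp: weak_roman_dominating_def)
    let ?g = "?F((x, v) := 1, (u, w) := ?F (u, w) - 1)"
    have "\<not> undefended ?P ?g z" for z
    proof (rule not_undefended_lexicographic_productI[OF G H D])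
      fix t assume t: "t \<in> D"
      show "\<exists>y\<in>pverts H. ?g (t, y) > 0"
      proof (cases "t = u")
        case True
        \<comment> \<open>Only the layer over \<open>u\<close> has lost a unit. If
          \<open>f w = 1\<close>, then \<open>w\<close> drops to 0 and another positive vertex is
          needed; if \<open>f w = 2\<close>, then \<open>w\<close> itself stays positive.\<close>
        show ?thesis
        proof (cases "f w = 1")
          case True
          then obtain w' where "w' \<in> pverts H" "w' \<noteq> w" "f w' > 0"
            using weak_roman_dominating_remaining[OF H nc f] by blast
          then show ?thesis
            using \<open>t = u\<close> u \<open>u \<noteq> x\<close> by (auto simp: layered_def intro!: bexI[of _ w'])
        next
          case False
          then show ?thesis
            using w w12 \<open>t = u\<close> u by (auto simp: layered_def intro!: bexI[of _ w])
        qed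
      next
        case False
        then show ?thesis
          using pos t x by (auto simp: layered_def)
      qed
      fix y assume y: "y \<in> pverts H"
      show "\<not> undefended ?P ?g (t, y)"
      proof (cases "t = u")
        case True
        \<comment> \<open>The depleted layer need not dominate itself: the unit just moved to
          \<open>(x, v)\<close> defends all of it from outside.\<close>
        have "((x, v), (t, y)) \<in> parcs ?P"
          using True u x v y DG G.arcs_symmetric by (auto simp: lexicographic_product_def)
        moreover have "?g (x, v) \<noteq> 0"
          using \<open>u \<noteq> x\<close> by simp
        ultimately show ?thesis
          by (metis undefended_def)
      next
        case False
        show ?thesis
          by (rule not_undefended_layerI[where h = f, OF H subsetD[OF DG t] y]) (use False t x fdef in \<open>auto simp: layered_def\<close>)
      qed
    qed
    moreover have "((u, w), (x, v)) \<in> parcs ?P"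
      using u DG w x v by (auto simp: lexicographic_product_def)
    moreover have "?F (u, w) \<in> {1, 2}"
      using w12 u by (simp add: layered_def)
    ultimately show ?thesis by blast
  qed
  have "?F ` pverts ?P \<subseteq> {0, 1, 2}"
    using f by (auto simp: layered_def lexicographic_product_def weak_roman_dominating_def)
  moreover have "\<exists>p. (p, q) \<in> parcs ?P \<and> ?F p \<in> {1, 2} \<and>
      \<not> (\<exists>z. undefended ?P (?F(q := 1, p := ?F p - 1)) z)"
    if q: "q \<in> pverts ?P" "?F q = 0" for q
  proof -
    obtain x v where xv: "q = (x, v)" by fastforce
    then have "x \<in> pverts G" "v \<in> pverts H"
      using q(1) by (auto simp: lexicographic_product_def)
    \<comment> \<open>Over \<open>D\<close> a zero of the layered function is a zero of
      \<open>f\<close>, as the first case requires; outside \<open>D\<close> every vertex has value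
      0.\<close>
    then show ?thesis
      using inner[of x v] outer[of x v] q(2) unfolding xv
      by (cases "x \<in> D") (simp_all add: layered_def)
  qed
  ultimately show ?thesis
    unfolding weak_roman_dominating_def by blast
qed

theorem theorem18:
  fixes G :: "'a pair_pre_digraph" and H :: "'b pair_pre_digraph"
  assumes "pair_graph G" and "pair_graph H"
    and "\<not> complete_graph H"
  shows "weak_roman_domination_number (lexicographic_product G H)
    \<le> domination_number G * weak_roman_domination_number H"
proof -
  interpret G: pair_graph G by fact
  obtain D where D: "dominating_set G D" "card D = domination_number G"
    using domination_number_attained by blast
  obtain f where f: "weak_roman_dominating H f" "weight H f = weak_roman_domination_number H"
    using weak_roman_domination_number_attained by blast
  have "weak_roman_domination_number (lexicographic_product G H)
      \<le> weight (lexicographic_product G H) (layered D f)"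
    unfolding weak_roman_domination_number_def
    using weak_roman_dominating_layered[OF assms D(1) f(1)] by (intro Least_le) blast
  also have "\<dots> = domination_number G * weak_roman_domination_number H"
    using weight_layered[of G D H f] D f(2) by (simp add: dominating_set_def)
  finally show ?thesis .
qed

end
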